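(* Let $k$ be a field and $d\ge 1$ an integer. If $\operatorname{char}k>d$, then the product of all the entries of the generic $d\times(2d-1)$ matrix lies in the ideal of its maximal permanents: $$\prod_{i=1}^{d}\prod_{j=1}^{2d-1}x_{i,j}\in I_d(d,2d-1).$$
   Context: The permanent of an $n\times n$ matrix $(a_{i,j})$ over a commutative ring is $\sum_{\sigma\in S_n}a_{1,\sigma(1)}\cdots a_{n,\sigma(n)}$. For a field $k$, $(x_{i,j})$ is the generic $d\times(2d-1)$ matrix of independent indeterminates over $k$, and $I_d(d,2d-1)\subset k[x_{i,j}]$ is the ideal generated by the permanents of all its $d\times d$ submatrices. *)

theory Defs
  imports
    "HOL-Library.Poly_Mapping"
    "HOL-Combinatorics.Permutations"
    "HOL-Computational_Algebra.Computational_Algebra"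
    "HOL-Algebra.Ideal"
begin

definition permanent :: "nat \<Rightarrow> (nat \<Rightarrow> nat \<Rightarrow> 'a) \<Rightarrow> 'a::comm_ring_1" where
  "permanent n a = (\<Sum>\<sigma> | \<sigma> permutes {1..n}. \<Prod>i=1..n. a i (\<sigma> i))"

text \<open>A monomial is a finitely supported exponent function, and a polynomial is a finitely
  supported function from monomials to coefficients.\<close>

type_synonym ('v, 'a) mpoly = "('v \<Rightarrow>\<^sub>0 nat) \<Rightarrow>\<^sub>0 'a"

definition Var :: "'v \<Rightarrow> ('v, 'a::comm_ring_1) mpoly" where
  "Var v = Poly_Mapping.single (Poly_Mapping.single v 1) 1"

text \<open>The polynomial ring whose indeterminates are exactly those indexed by \<open>V\<close>. The restriction
  of the carrier matters because the index type may be larger than \<open>V\<close>.\<close>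

definition mpoly_ring :: "'v set \<Rightarrow> ('v, 'a::comm_ring_1) mpoly ring" where
  "mpoly_ring V =
    \<lparr>carrier = {p. \<forall>m \<in> Poly_Mapping.keys p. Poly_Mapping.keys m \<subseteq> V},
     mult = (*), one = 1, zero = 0, add = (+)\<rparr>"

abbreviation generic_ring :: "nat \<Rightarrow> nat \<Rightarrow> (nat \<times> nat, 'a::comm_ring_1) mpoly ring" where
  "generic_ring m n \<equiv> mpoly_ring ({1..m} \<times> {1..n})"

definition generic_matrix :: "nat \<Rightarrow> nat \<Rightarrow> (nat \<times> nat, 'a::comm_ring_1) mpoly" where
  "generic_matrix i j = Var (i, j)"

text \<open>A \<open>t \<times> t\<close> submatrix of an \<open>m \<times> n\<close> matrix is given by strictly increasing
  selections \<open>r\<close> of rows and \<open>c\<close> of columns.\<close>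

definition subpermanents :: "nat \<Rightarrow> nat \<Rightarrow> nat \<Rightarrow> (nat \<times> nat, 'a::comm_ring_1) mpoly set" where
  "subpermanents t m n =
    {permanent t (\<lambda>i j. generic_matrix (r i) (c j)) | r c.
       strict_mono_on {1..t} r \<and> r ` {1..t} \<subseteq> {1..m} \<and>
       strict_mono_on {1..t} c \<and> c ` {1..t} \<subseteq> {1..n}}"

definition permanental_ideal :: "nat \<Rightarrow> nat \<Rightarrow> nat \<Rightarrow> (nat \<times> nat, 'a::comm_ring_1) mpoly set" where
  "permanental_ideal t m n = Idl\<^bsub>generic_ring m n\<^esub> (subpermanents t m n)"

text \<open>\<open>Idl\<close> is an intersection of ideals, hence meaningful only because the record is a ring
  that contains the generators.\<close>

lemma mpoly_ring_simps:
  "p \<in> carrier (mpoly_ring V) \<longleftrightarrow> (\<forall>m \<in> Poly_Mapping.keys p. Poly_Mapping.keys m \<subseteq> V)"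
  "mult (mpoly_ring V) = (*)" "one (mpoly_ring V) = 1"
  "zero (mpoly_ring V) = 0" "add (mpoly_ring V) = (+)"
  by (simp_all add: mpoly_ring_def)

lemma mpoly_ring_closed:
  fixes p q :: "('v, 'a::comm_ring_1) mpoly"
  assumes "p \<in> carrier (mpoly_ring V)" "q \<in> carrier (mpoly_ring V)"
  shows "p + q \<in> carrier (mpoly_ring V)" "p * q \<in> carrier (mpoly_ring V)"
    "- p \<in> carrier (mpoly_ring V)"
proof -
  show "p + q \<in> carrier (mpoly_ring V)"
    using assms keys_add[of p q] unfolding mpoly_ring_simps by blast
  show "p * q \<in> carrier (mpoly_ring V)"
    unfolding mpoly_ring_simps
  proof
    fix m assume "m \<in> Poly_Mapping.keys (p * q)"
    then obtain a b where "m = a + b" "a \<in> Poly_Mapping.keys p" "b \<in> Poly_Mapping.keys q"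
      using keys_mult[of p q] by blast
    then show "Poly_Mapping.keys m \<subseteq> V"
      using assms keys_add[of a b] unfolding mpoly_ring_simps by blast
  qed
  show "- p \<in> carrier (mpoly_ring V)"
    using assms unfolding mpoly_ring_simps by (simp add: in_keys_iff)
qed

lemma cring_mpoly_ring: "cring (mpoly_ring V :: ('v, 'a::comm_ring_1) mpoly ring)"
proof (rule cringI)
  show "abelian_group (mpoly_ring V :: ('v, 'a) mpoly ring)"
  proof (rule abelian_groupI)
    fix p :: "('v, 'a) mpoly" assume "p \<in> carrier (mpoly_ring V)"
    then show "\<exists>y\<in>carrier (mpoly_ring V). y \<oplus>\<^bsub>mpoly_ring V\<^esub> p = \<zero>\<^bsub>mpoly_ring V\<^esub>"
      by (intro bexI[of _ "- p"]) (simp_all add: mpoly_ring_closed mpoly_ring_simps(4,5))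
  qed (simp_all add: mpoly_ring_closed mpoly_ring_simps(4,5) ac_simps, simp add: mpoly_ring_simps)
  show "Group.comm_monoid (mpoly_ring V :: ('v, 'a) mpoly ring)"
    by (rule comm_monoidI)
       (simp_all add: mpoly_ring_closed mpoly_ring_simps(2,3) ac_simps, simp add: mpoly_ring_simps)
qed (simp add: mpoly_ring_simps algebra_simps)

lemma Var_in_carrier: "v \<in> V \<Longrightarrow> Var v \<in> carrier (mpoly_ring V)"
  by (simp add: mpoly_ring_simps Var_def)

lemma sum_prod_in_carrier:
  fixes f :: "'b \<Rightarrow> ('v, 'a::comm_ring_1) mpoly"
  assumes "\<And>x. x \<in> A \<Longrightarrow> f x \<in> carrier (mpoly_ring V)"
  shows "sum f A \<in> carrier (mpoly_ring V)" "prod f A \<in> carrier (mpoly_ring V)"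
proof -
  have 0: "0 \<in> carrier (mpoly_ring V :: ('v, 'a) mpoly ring)"
    "1 \<in> carrier (mpoly_ring V :: ('v, 'a) mpoly ring)"
    by (simp_all add: mpoly_ring_simps)
  show "sum f A \<in> carrier (mpoly_ring V)" "prod f A \<in> carrier (mpoly_ring V)"
    using assms by (induction A rule: infinite_finite_induct) (simp_all add: 0 mpoly_ring_closed)
qed

lemma subpermanents_subset_carrier: "subpermanents t m n \<subseteq> carrier (generic_ring m n)"
proof -
  have "permanent t (\<lambda>i j. generic_matrix (r i) (c j)) \<in> carrier (generic_ring m n)"
    if "r ` {1..t} \<subseteq> {1..m}" "c ` {1..t} \<subseteq> {1..n}" for r c
    unfolding permanent_def generic_matrix_def
  proof (intro sum_prod_in_carrier Var_in_carrier SigmaI)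
    fix \<sigma> i assume "\<sigma> \<in> {\<sigma>. \<sigma> permutes {1..t}}" and i: "i \<in> {1..t}"
    then have "\<sigma> i \<in> {1..t}" by (simp only: mem_Collect_eq permutes_in_image)
    then show "r i \<in> {1..m}" "c (\<sigma> i) \<in> {1..n}" using that i by (simp_all only: image_subset_iff)
  qed
  then show ?thesis unfolding subpermanents_def by blast
qed

lemma ideal_permanental_ideal: "ideal (permanental_ideal t m n) (generic_ring m n)"
  unfolding permanental_ideal_def
  by (intro ring.genideal_ideal cring.axioms(1) cring_mpoly_ring subpermanents_subset_carrier)

end

theory Submission
  imports Defs
begin

text \<open>Over \<open>R[t\<^sub>j]/(t\<^sub>j\<^sup>2)\<close> with \<open>R = k[x\<^sub>i\<^sub>,\<^sub>j]\<close> put \<open>l\<^sub>i = \<Sum>\<^sub>j x\<^sub>i\<^sub>,\<^sub>j t\<^sub>j\<close>. The coefficients of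
  \<open>l\<^sub>1 \<cdots> l\<^sub>d\<close> are the maximal permanents, hence lie in the permanental ideal. Peel off the linear forms
  one after the other: after rescaling the \<open>t\<^sub>j\<close> (which costs the product of row \<open>r\<close>), multiplication
  by \<open>l\<^sub>r\<close> becomes the inclusion operator from \<open>(r - 1)\<close>-sets to \<open>r\<close>-sets of columns, which is
  injective because \<open>2 (r - 1) + 1 \<le> 2 d - 1\<close> and \<open>1, \<dots>, r\<close> are invertible in \<open>k\<close>. After \<open>d\<close> steps
  the polynomial \<open>1\<close> is left, multiplied by the product of all rows.\<close>

text \<open>Exchanging an element of \<open>S\<close> for one outside \<open>S\<close> changes
  \<open>g S\<close> only by an element of \<open>J\<close>, by induction on \<open>k\<close>; each
  exchange uses up two points of \<open>V\<close>, whence the bound \<open>2 * k + 1\<close>. So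
  modulo \<open>J\<close> the sum over \<open>insert v S\<close> is \<open>k + 1\<close> times
  \<open>g S\<close>.\<close>

lemma inclusion_operator_injective:
  fixes g :: "'v set \<Rightarrow> 'b::comm_ring_1" and J :: "'b set"
  assumes diff: "\<And>x y. x \<in> J \<Longrightarrow> y \<in> J \<Longrightarrow> x - y \<in> J"
    and cancel: "\<And>m x. 1 \<le> m \<Longrightarrow> m \<le> Suc k \<Longrightarrow> of_nat m * x \<in> J \<Longrightarrow> x \<in> J"
    and "finite V" and "2 * k + 1 \<le> card V"
    and "\<And>T. T \<subseteq> V \<Longrightarrow> card T = Suc k \<Longrightarrow> (\<Sum>j\<in>T. g (T - {j})) \<in> J"
    and "S \<subseteq> V" and "card S = k"
  shows "g S \<in> J"
  using assms(2-)
proof (induction k arbitrary: g V S)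
  case 0
  then obtain v where "v \<in> V" by fastforce
  with 0(4)[of "{v}"] 0(1,2,5,6) show ?case
    by (auto dest: finite_subset)
next
  case (Suc k)
  \<comment> \<open>The difference of \<open>g\<close> in two directions \<open>a, b\<close> satisfies the hypothesis again, one level lower.\<close>
  have swap: "g (insert a Q) - g (insert b Q) \<in> J"
    if Q: "Q \<subseteq> V - {a, b}" "card Q = k" and ab: "a \<in> V" "b \<in> V" "a \<noteq> b" for a b Q
  proof (rule Suc.IH[where V = "V - {a, b}" and g = "\<lambda>Q. g (insert a Q) - g (insert b Q)"])
    show "finite (V - {a, b})" using Suc.prems(2) by simp
    show "2 * k + 1 \<le> card (V - {a, b})"
      using Suc.prems(2,3) ab by (simp add: card_Diff_subset)
    show "x \<in> J" if "1 \<le> m" "m \<le> Suc k" "of_nat m * x \<in> J" for m x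
      using Suc.prems(1)[of m x] that by simp
    fix T assume T: "T \<subseteq> V - {a, b}" "card T = Suc k"
    have fin: "finite T" using T(2) by (simp add: card_ge_0_finite)
    \<comment> \<open>The summand \<open>g T\<close> does not depend on \<open>c\<close>, so it
      cancels between \<open>c = a\<close> and \<open>c = b\<close>.\<close>
    have *: "(\<Sum>j\<in>insert c T. g (insert c T - {j})) = g T + (\<Sum>j\<in>T. g (insert c (T - {j})))"
      if "c \<notin> T" for c
    proof -
      have "(\<Sum>j\<in>T. g (insert c T - {j})) = (\<Sum>j\<in>T. g (insert c (T - {j})))"
        using that by (intro sum.cong refl arg_cong[of _ _ g]) auto
      then show ?thesis using that fin by simp
    qed
    have nab: "a \<notin> T" "b \<notin> T" using T by auto
    have mem: "(\<Sum>j\<in>insert c T. g (insert c T - {j})) \<in> J" if "c \<in> {a, b}" for c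
      using that T ab fin nab by (intro Suc.prems(4)) auto
    show "(\<Sum>j\<in>T. g (insert a (T - {j})) - g (insert b (T - {j}))) \<in> J"
      using diff[OF mem[of a] mem[of b]] *[OF nab(1)] *[OF nab(2)] by (simp add: sum_subtractf)
  qed (use Q in auto)
  have "card S < card V" using Suc.prems(3,6) by simp
  then obtain v where v: "v \<in> V" "v \<notin> S"
    using Suc.prems(5) by (metis less_irrefl subsetI subset_antisym)
  have fin: "finite S" using Suc.prems(2,5) finite_subset by blast
  let ?T = "insert v S"
  \<comment> \<open>The sum for \<open>?T\<close> lies in \<open>J\<close>; subtracting it from
    itself gives \<open>0\<close>.\<close>
  have zero: "0 \<in> J" using diff[OF Suc.prems(4)[of ?T] Suc.prems(4)[of ?T]] v Suc.prems(5,6) fin by simp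
  have add: "x + y \<in> J" if "x \<in> J" "y \<in> J" for x y
    using diff[OF that(1) diff[OF zero that(2)]] by simp
  have near: "g S - g (?T - {j}) \<in> J" if j: "j \<in> ?T" for j
  proof (cases "j = v")
    case True
    then show ?thesis using v zero by simp
  next
    case False
    then have "j \<in> S" using j by simp
    then have "insert j (S - {j}) = S" "insert v (S - {j}) = ?T - {j}" using v by auto
    moreover have "g (insert j (S - {j})) - g (insert v (S - {j})) \<in> J"
      using \<open>j \<in> S\<close> v Suc.prems(5,6) fin False by (intro swap) auto
    ultimately show ?thesis by simp
  qed
  have "(\<Sum>j\<in>A. g S - g (?T - {j})) \<in> J" if "finite A" "A \<subseteq> ?T" for A
    using that by (induction A rule: finite_induct) (simp_all add: zero add near)
  then have "(\<Sum>j\<in>?T. g S - g (?T - {j})) \<in> J" using fin by blast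
  moreover have "(\<Sum>j\<in>?T. g (?T - {j})) \<in> J"
    using v Suc.prems(5,6) fin by (intro Suc.prems(4)) auto
  ultimately have "(\<Sum>j\<in>?T. g S - g (?T - {j})) + (\<Sum>j\<in>?T. g (?T - {j})) \<in> J" by (rule add)
  \<comment> \<open>The terms \<open>g (?T - {j})\<close> cancel, leaving one \<open>g S\<close> for
    each of the \<open>k + 2\<close> elements of \<open>?T\<close>.\<close>
  moreover have "(\<Sum>j\<in>?T. g S - g (?T - {j})) + (\<Sum>j\<in>?T. g (?T - {j})) = of_nat (Suc (Suc k)) * g S"
    using v fin Suc.prems(6) by (simp only: sum.distrib[symmetric]) (simp del: of_nat_Suc)
  ultimately show ?case using Suc.prems(1)[of "Suc (Suc k)" "g S"] by simp
qed

text \<open>Only meaningful for \<open>card T = r\<close>; then it is the coefficient of \<open>\<Prod>\<^sub>j\<^sub>\<in>\<^sub>T t\<^sub>j\<close> in \<open>l\<^sub>1 \<cdots> l\<^sub>r\<close>, that is,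
  the permanent of the rows \<open>1, \<dots>, r\<close> and the columns in \<open>T\<close>.\<close>

primrec set_permanent :: "(nat \<Rightarrow> 'v \<Rightarrow> 'b) \<Rightarrow> nat \<Rightarrow> 'v set \<Rightarrow> 'b::comm_ring_1" where
  "set_permanent x 0 T = 1"
| "set_permanent x (Suc r) T = (\<Sum>j\<in>T. x (Suc r) j * set_permanent x r (T - {j}))"

text \<open>Each permutation of \<open>{1..Suc r}\<close> is uniquely
  \<open>transpose (Suc r) b \<circ> q\<close> with \<open>q\<close> fixing \<open>Suc r\<close>.
  Sorting by \<open>b\<close>, the image of \<open>Suc r\<close>, gives the Laplace expansion along
  the last row.\<close>

lemma permanent_Suc:
  "permanent (Suc r) a =
    (\<Sum>b=1..Suc r. a (Suc r) b * permanent r (\<lambda>i j. a i (transpose (Suc r) b j)))"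
proof -
  have ins: "{1..Suc r} = insert (Suc r) {1..r}" by auto
  have "(\<Prod>i=1..Suc r. a i ((transpose (Suc r) b \<circ> q) i))
      = a (Suc r) b * (\<Prod>i=1..r. a i (transpose (Suc r) b (q i)))"
    if "q permutes {1..r}" for b q
    using permutes_not_in[OF that, of "Suc r"] unfolding ins by simp
  then show ?thesis
    unfolding permanent_def ins
    by (subst sum_over_permutations_insert) (simp_all add: sum_distrib_left flip: ins)
qed

text \<open>Deleting column \<open>c b\<close> composes \<open>c\<close> with a transposition, which
  can destroy monotonicity; the induction therefore runs over all injective enumerations.\<close>

lemma permanent_eq_set_permanent:
  assumes "inj_on c {1..r}"
  shows "permanent r (\<lambda>i j. x i (c j)) = set_permanent x r (c ` {1..r})"
  using assms
proof (induction r arbitrary: c)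
  case 0
  then show ?case by (simp add: permanent_def)
next
  case (Suc r)
  have "permanent r (\<lambda>i j. x i (c (transpose (Suc r) b j)))
      = set_permanent x r (c ` {1..Suc r} - {c b})" if b: "b \<in> {1..Suc r}" for b
  proof -
    let ?t = "transpose (Suc r) b"
    have img: "?t ` {1..r} = {1..Suc r} - {b}"
    proof -
      have "?t permutes {1..Suc r}" using b by (intro permutes_swap_id) auto
      then have "?t ` {1..Suc r} = {1..Suc r}" by (rule permutes_image)
      moreover have "{1..r} = {1..Suc r} - {Suc r}" by auto
      ultimately show ?thesis by (simp add: image_set_diff)
    qed
    have "inj_on (c \<circ> ?t) {1..r}"
      using Suc.prems img by (intro comp_inj_on) (auto intro: inj_on_subset)
    then have "permanent r (\<lambda>i j. x i ((c \<circ> ?t) j)) = set_permanent x r ((c \<circ> ?t) ` {1..r})"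
      by (rule Suc.IH)
    moreover have "(c \<circ> ?t) ` {1..r} = c ` {1..Suc r} - {c b}"
      using b Suc.prems by (simp only: image_comp[symmetric] img) (auto simp: inj_on_def)
    ultimately show ?thesis by simp
  qed
  then show ?case
    using Suc.prems by (simp add: permanent_Suc sum.reindex del: sum.cl_ivl_Suc)
qed

lemma prod_rows_in_if_set_permanents_in:
  fixes x :: "nat \<Rightarrow> 'v \<Rightarrow> 'b::comm_ring_1" and J :: "'b set"
  assumes diff: "\<And>y z. y \<in> J \<Longrightarrow> z \<in> J \<Longrightarrow> y - z \<in> J"
    and mult: "\<And>i j y. i \<in> {1..d} \<Longrightarrow> j \<in> V \<Longrightarrow> y \<in> J \<Longrightarrow> x i j * y \<in> J"
    and cancel: "\<And>m y. 1 \<le> m \<Longrightarrow> m \<le> d \<Longrightarrow> of_nat m * y \<in> J \<Longrightarrow> y \<in> J"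
    and V: "finite V" "2 * d \<le> Suc (card V)"
    and perm: "\<And>T. T \<subseteq> V \<Longrightarrow> card T = d \<Longrightarrow> set_permanent x d T \<in> J"
  shows "(\<Prod>i=1..d. \<Prod>j\<in>V. x i j) \<in> J"
proof -
  let ?Y = "\<lambda>r. \<Prod>i=Suc r..d. \<Prod>j\<in>V. x i j"
  have mult_prod: "(\<Prod>j\<in>A. x i j) * y \<in> J" if "A \<subseteq> V" "i \<in> {1..d}" "y \<in> J" for A i y
  proof -
    have "finite A" using that V finite_subset by blast
    then show ?thesis using that
      by (induction A rule: finite_induct) (simp_all add: mult mult.assoc)
  qed
  \<comment> \<open>Downward induction from \<open>r = d\<close>, where \<open>?Y d\<close> is the
    empty product, to \<open>r = 0\<close>, where \<open>?Y 0\<close> is the product of all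
    rows.\<close>
  have "\<forall>S. S \<subseteq> V \<and> card S = 0 \<longrightarrow> ?Y 0 * set_permanent x 0 S \<in> J"
  proof (rule inc_induct[of 0 d "\<lambda>r. \<forall>S. S \<subseteq> V \<and> card S = r \<longrightarrow> ?Y r * set_permanent x r S \<in> J"])
    show "\<forall>S. S \<subseteq> V \<and> card S = d \<longrightarrow> ?Y d * set_permanent x d S \<in> J"
      using perm by simp
  next
    fix r assume r: "r < d"
      and IH: "\<forall>S. S \<subseteq> V \<and> card S = Suc r \<longrightarrow> ?Y (Suc r) * set_permanent x (Suc r) S \<in> J"
    show "\<forall>S. S \<subseteq> V \<and> card S = r \<longrightarrow> ?Y r * set_permanent x r S \<in> J"
    proof (intro allI impI, elim conjE)
      fix S assume S: "S \<subseteq> V" "card S = r"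
      \<comment> \<open>The rescaling without fractions: the weight is the product of row
        \<open>Suc r\<close> divided by its part over \<open>Q\<close>. Passing from
        \<open>T\<close> to \<open>T - {j}\<close> then supplies the factor
        \<open>x (Suc r) j\<close> of the expansion of
        \<open>set_permanent x (Suc r) T\<close>.\<close>
      define g where
        "g Q = ?Y (Suc r) * set_permanent x r Q * (\<Prod>j\<in>V - Q. x (Suc r) j)" for Q
      have "g S \<in> J"
      proof (rule inclusion_operator_injective[of J r V g S])
        \<comment> \<open>Since \<open>r < d\<close>,
          \<open>2 * r + 1 \<le> 2 * d - 1 \<le> card V\<close>.\<close>
        show "2 * r + 1 \<le> card V" using r V(2) by simp
        show "y \<in> J" if "1 \<le> m" "m \<le> Suc r" "of_nat m * y \<in> J" for m y
          using cancel[of m y] that r by simp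
        fix T assume T: "T \<subseteq> V" "card T = Suc r"
        have "g (T - {j}) = (\<Prod>j\<in>V - T. x (Suc r) j) *
            (?Y (Suc r) * (x (Suc r) j * set_permanent x r (T - {j})))" if "j \<in> T" for j
        proof -
          have "V - (T - {j}) = insert j (V - T)" using T that by auto
          then show ?thesis using V(1) that by (simp add: g_def ac_simps)
        qed
        then have "(\<Sum>j\<in>T. g (T - {j})) =
            (\<Prod>j\<in>V - T. x (Suc r) j) * (?Y (Suc r) * set_permanent x (Suc r) T)"
          by (simp add: sum_distrib_left)
        then show "(\<Sum>j\<in>T. g (T - {j})) \<in> J"
          using mult_prod[of "V - T" "Suc r"] IH T r by simp
      qed (use diff V S in auto)
      \<comment> \<open>The entries over \<open>S\<close> complete the weight of \<open>g S\<close>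
        to the full row \<open>Suc r\<close>.\<close>
      then have "(\<Prod>j\<in>S. x (Suc r) j) * g S \<in> J" using S r by (intro mult_prod) auto
      moreover have "(\<Prod>j\<in>S. x (Suc r) j) * g S = ?Y r * set_permanent x r S"
      proof -
        have row: "(\<Prod>j\<in>V. x (Suc r) j) = (\<Prod>j\<in>V - S. x (Suc r) j) * (\<Prod>j\<in>S. x (Suc r) j)"
          using V(1) S(1) by (intro prod.subset_diff)
        have "?Y r = (\<Prod>j\<in>V. x (Suc r) j) * ?Y (Suc r)"
          using r by (intro prod.atLeast_Suc_atMost) simp
        then show ?thesis unfolding row g_def by (simp add: ac_simps)
      qed
      ultimately show "?Y r * set_permanent x r S \<in> J" by simp
    qed
  qed simp
  then have "?Y 0 * set_permanent x 0 {} \<in> J" by (metis card.empty empty_subsetI)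
  then show ?thesis by simp
qed

text \<open>The increasing enumeration of \<open>T\<close> selects the columns; all \<open>d\<close>
  rows are taken, so the row selection is \<open>id\<close>.\<close>

lemma set_permanent_in_subpermanents:
  assumes "T \<subseteq> {1..n}" and "card T = d"
  shows "set_permanent generic_matrix d T \<in>
    (subpermanents d d n :: (nat \<times> nat, 'a::comm_ring_1) mpoly set)"
proof -
  have "finite T" using assms(1) finite_subset by blast
  then obtain h where h: "bij_betw h {..<d} T" "strict_mono_on {..<d} h"
    using ex_bij_betw_strict_mono_card assms(2) by metis
  define c where "c j = h (j - 1)" for j
  have c: "strict_mono_on {1..d} c"
    by (auto simp: c_def intro!: strict_mono_onI strict_mono_onD[OF h(2)])
  have shift: "(\<lambda>j. j - 1) ` {1..d} = {..<d}"
    by (force simp: image_iff intro: bexI[of _ "Suc _"])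
  have "c ` {1..d} = h ` (\<lambda>j. j - 1) ` {1..d}"
    by (auto simp: c_def image_image)
  then have img: "c ` {1..d} = T"
    using h(1) unfolding shift by (simp add: bij_betw_def)
  have "(set_permanent generic_matrix d T :: (nat \<times> nat, 'a) mpoly) =
      permanent d (\<lambda>i j. generic_matrix (id i) (c j))"
    unfolding id_apply img[symmetric]
    by (rule permanent_eq_set_permanent[OF strict_mono_on_imp_inj_on[OF c], symmetric])
  moreover have "strict_mono_on {1..d} (id :: nat \<Rightarrow> nat)" by (simp add: strict_mono_on_def)
  moreover have "id ` {1..d} \<subseteq> {1..d}" by simp
  moreover have "c ` {1..d} \<subseteq> {1..n}" using img assms(1) by (simp only:)
  ultimately show ?thesis
    unfolding subpermanents_def mem_Collect_eq using c by (intro exI conjI)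
qed

theorem corollary6:
  fixes d :: nat
  assumes "d \<ge> 1"
    and "CHAR('a::field) > d"
  shows "(\<Prod>i=1..d. \<Prod>j=1..2 * d - 1. generic_matrix i j)
    \<in> (permanental_ideal d d (2 * d - 1) :: (nat \<times> nat, 'a) mpoly set)"
proof -
  let ?R = "generic_ring d (2 * d - 1) :: (nat \<times> nat, 'a) mpoly ring"
  let ?J = "permanental_ideal d d (2 * d - 1) :: (nat \<times> nat, 'a) mpoly set"
  have J: "ideal ?J ?R" by (rule ideal_permanental_ideal)
  have J_mult: "q * y \<in> ?J" if "q \<in> carrier ?R" "y \<in> ?J" for q y
    using ideal.I_l_closed[OF J that(2,1)] by (simp add: mpoly_ring_simps)
  have J_add: "y + z \<in> ?J" if "y \<in> ?J" "z \<in> ?J" for y z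
    using additive_subgroup.a_closed[OF ideal.axioms(1)[OF J] that] by (simp add: mpoly_ring_simps)
  have const: "Poly_Mapping.single 0 c \<in> carrier ?R" for c
    by (simp add: mpoly_ring_simps)
  show ?thesis
  proof (rule prod_rows_in_if_set_permanents_in)
    fix y z assume yz: "y \<in> ?J" "z \<in> ?J"
    have "1 \<in> carrier ?R" by (simp add: mpoly_ring_simps)
    then have "- 1 * z \<in> ?J" using mpoly_ring_closed(3) yz(2) by (intro J_mult)
    then show "y - z \<in> ?J" using J_add[OF yz(1)] by fastforce
  next
    fix i j and y :: "(nat \<times> nat, 'a) mpoly"
    assume "i \<in> {1..d}" "j \<in> {1..2 * d - 1}" "y \<in> ?J"
    then show "generic_matrix i j * y \<in> ?J"
      unfolding generic_matrix_def by (intro J_mult Var_in_carrier) simp_all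
  next
    fix m and y :: "(nat \<times> nat, 'a) mpoly"
    assume m: "1 \<le> m" "m \<le> d" and y: "of_nat m * y \<in> ?J"
    \<comment> \<open>The characteristic exceeds \<open>m\<close>, so it cannot divide
      \<open>m\<close>; the constant polynomial \<open>1/m\<close> then cancels
      \<open>m\<close>.\<close>
    have "(of_nat m :: 'a) \<noteq> 0"
      using m assms(2) by (auto simp: of_nat_eq_0_iff_char_dvd dest: dvd_imp_le)
    then have "Poly_Mapping.single 0 (inverse (of_nat m)) * of_nat m = (1 :: (nat \<times> nat, 'a) mpoly)"
      by (simp add: mult_single flip: single_of_nat)
    then show "y \<in> ?J"
      using J_mult[OF const[of "inverse (of_nat m)"] y] by (simp flip: mult.assoc)
  next
    fix T assume "T \<subseteq> {1..2 * d - 1}" "card T = d"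
    then have "set_permanent generic_matrix d T \<in> subpermanents d d (2 * d - 1)"
      by (rule set_permanent_in_subpermanents)
    then show "set_permanent generic_matrix d T \<in> ?J"
      unfolding permanental_ideal_def
      using ring.genideal_self[OF cring.axioms(1)[OF cring_mpoly_ring] subpermanents_subset_carrier]
      by blast
  qed simp_all
qed

end
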